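(* Let $A_2\in\mathbb{C}^{N_2\times N_2}$ be an invertible matrix such that $A_2^n=tA_2^2$ holds for some $n>2$ and $t\neq 0$, and let $Y_4\in\mathbb{C}^{N_2\times N_2}$ be arbitrary. Consider the system $$\begin{cases}A_2X_4A_2=X_4A_2X_4+\widehat{Y_3}A_1\widehat{Y_2},\\ A_2X_4-X_4A_2=Y_4\end{cases}\qquad(\ast)$$ in the unknown $X_4\in\mathbb{C}^{N_2\times N_2}$. If $(\ast)$ is consistent, then every solution $X_4$ of $(\ast)$ also solves the Sylvester equation $$Y_4A_2X_4+X_4A_2Y_4=A_2Y_4A_2+\left(\widehat{Y_3}A_1\widehat{Y_2}\right)A_2-A_2\left(\widehat{Y_3}A_1\widehat{Y_2}\right).\qquad(\ast\ast)$$ Conversely, if $(\ast\ast)$ is unsolvable for $X_4$, then the system $(\ast)$ is inconsistent.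
   Context: All matrices are complex. $A_1\in\mathbb{C}^{N_1\times N_1}$ satisfies $A_1^2=0$ ($A_1$ and $A_2$ are the nilpotent and invertible blocks of a matrix $A$ with $A^n=tA^2$ with respect to $\mathbb{C}^N=\mathcal{N}(A^2)\oplus\mathcal{R}(A^2)$). For given $Y_2\in\mathbb{C}^{N_1\times N_2}$ and $Y_3\in\mathbb{C}^{N_2\times N_1}$, $$\widehat{Y_2}=-(Y_2+A_1Y_2A_2^{-1})A_2^{-1},\qquad \widehat{Y_3}=A_2^{-1}(Y_3+A_2^{-1}Y_3A_1).$$ *)

theory Defs
  imports "Jordan_Normal_Form.Gauss_Jordan_Elimination"
begin

text \<open>
  Dimensions are carried by \<^const>\<open>carrier_mat\<close>, so the blocks may also be of size zero.
  Since \<^const>\<open>mat_inverse\<close> is option-valued, the inverse of an invertible matrix is obtained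
  by removing the option; \<open>mat_inv_invertible\<close> shows that this is the two-sided inverse.
\<close>

definition mat_inv :: "complex mat \<Rightarrow> complex mat" where
  "mat_inv A = the (mat_inverse A)"

lemma mat_inv_invertible:
  assumes A: "A \<in> carrier_mat n n" and inv: "invertible_mat A"
  shows "mat_inv A \<in> carrier_mat n n" "A * mat_inv A = 1\<^sub>m n" "mat_inv A * A = 1\<^sub>m n"
proof -
  obtain B where AB: "A * B = 1\<^sub>m n" and BA: "B * A = 1\<^sub>m (dim_row B)"
    using A inv unfolding invertible_mat_def inverts_mat_def by auto
  have "dim_col B = n" using arg_cong[OF AB, of dim_col] by simp
  moreover have "dim_row B = n" using arg_cong[OF BA, of dim_col] A by simp
  ultimately have B: "B \<in> carrier_mat n n" and BA': "B * A = 1\<^sub>m n" using BA by auto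
  have "A \<in> Units (ring_mat TYPE(complex) n ())"
    unfolding Units_def using A B AB BA' by (auto simp: ring_mat_simps)
  then obtain C where C: "mat_inverse A = Some C"
    using mat_inverse(1)[OF A, where b = "()"] by (cases "mat_inverse A") auto
  from mat_inverse(2)[OF A C] C
  show "mat_inv A \<in> carrier_mat n n" "A * mat_inv A = 1\<^sub>m n" "mat_inv A * A = 1\<^sub>m n"
    unfolding mat_inv_def by auto
qed

definition hat_Y2 :: "complex mat \<Rightarrow> complex mat \<Rightarrow> complex mat \<Rightarrow> complex mat" where
  "hat_Y2 A1 A2 Y2 = - ((Y2 + A1 * Y2 * mat_inv A2) * mat_inv A2)"

definition hat_Y3 :: "complex mat \<Rightarrow> complex mat \<Rightarrow> complex mat \<Rightarrow> complex mat" where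
  "hat_Y3 A1 A2 Y3 = mat_inv A2 * (Y3 + mat_inv A2 * Y3 * A1)"

text \<open>In the next two definitions \<open>H\<close> stands for the product
  \<open>hat_Y3 A1 A2 Y3 * A1 * hat_Y2 A1 A2 Y2\<close>.\<close>

definition solves_system ::
    "nat \<Rightarrow> complex mat \<Rightarrow> complex mat \<Rightarrow> complex mat \<Rightarrow> complex mat \<Rightarrow> bool" where
  "solves_system N A2 H Y4 X4 \<longleftrightarrow>
     X4 \<in> carrier_mat N N \<and>
     A2 * X4 * A2 = X4 * A2 * X4 + H \<and>
     A2 * X4 - X4 * A2 = Y4"

definition solves_sylvester ::
    "nat \<Rightarrow> complex mat \<Rightarrow> complex mat \<Rightarrow> complex mat \<Rightarrow> complex mat \<Rightarrow> bool" where
  "solves_sylvester N A2 H Y4 X4 \<longleftrightarrow>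
     X4 \<in> carrier_mat N N \<and>
     Y4 * A2 * X4 + X4 * A2 * Y4 = A2 * Y4 * A2 + H * A2 - A2 * H"

end

theory Submission
  imports Defs
begin

text \<open>
  Commutation with \<open>A2\<close>, the map \<open>M \<mapsto> A2 * M - M * A2\<close>, is additive and satisfies the Leibniz
  rule, and it annihilates \<open>A2\<close> itself. It therefore sends \<open>X4 * A2 * X4\<close> to
  \<open>Y4 * A2 * X4 + X4 * A2 * Y4\<close> and \<open>A2 * X4 * A2\<close> to \<open>A2 * Y4 * A2\<close>, once the second equation of
  the system is used to name the commutator of \<open>A2\<close> and \<open>X4\<close> as \<open>Y4\<close>. So commuting the first
  (quadratic) equation of the system with \<open>A2\<close> produces exactly the Sylvester equation, which is
  linear in \<open>X4\<close>. The second half of the theorem is the contrapositive.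
\<close>

text \<open>This is the Leibniz rule for commutation with \<open>A\<close>; the middle factor contributes nothing
  because \<open>A\<close> commutes with itself. On the right-hand side the product \<open>X * A * A * X\<close> arises from
  both summands, with opposite signs.\<close>

lemma commutator_XAX:
  fixes A X :: "'a :: ring mat"
  assumes A: "A \<in> carrier_mat n n" and X: "X \<in> carrier_mat n n"
  shows "A * (X * A * X) - (X * A * X) * A = (A * X - X * A) * A * X + X * A * (A * X - X * A)"
proof -
  have L: "(A * X - X * A) * A * X = A * (X * A * X) - X * A * A * X"
    using A X by (simp add: minus_mult_distrib_mat[of _ n n _ _ n] assoc_mult_mat[of _ n n _ n _ n])
  have R: "X * A * (A * X - X * A) = X * A * A * X - X * A * X * A"
    using A X by (simp add: mult_minus_distrib_mat[of _ n n _ n] assoc_mult_mat[of _ n n _ n _ n])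
  have "P - R = (P - Q) + (Q - R)"
    if "P \<in> carrier_mat n n" "Q \<in> carrier_mat n n" "R \<in> carrier_mat n n" for P Q R :: "'a mat"
    using that by (intro eq_matI) auto
  then show ?thesis
    unfolding L R by (rule) (use A X in auto)
qed

lemma commutator_AXA:
  fixes A X :: "'a :: ring mat"
  assumes A: "A \<in> carrier_mat n n" and X: "X \<in> carrier_mat n n"
  shows "A * (A * X * A) - (A * X * A) * A = A * (A * X - X * A) * A"
  using A X by (simp add: minus_mult_distrib_mat[of _ n n _ _ n]
      mult_minus_distrib_mat[of _ n n _ n] assoc_mult_mat[of _ n n _ n _ n])

lemma sylvester_if_system:
  assumes A: "A \<in> carrier_mat N N" and H: "H \<in> carrier_mat N N"
    and sys: "solves_system N A H Y X"
  shows "solves_sylvester N A H Y X"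
proof -
  from sys have X: "X \<in> carrier_mat N N" and quad: "A * X * A = X * A * X + H"
    and Y: "Y = A * X - X * A"
    unfolding solves_system_def by auto
  let ?Q = "X * A * X"
  have Q: "?Q \<in> carrier_mat N N" using A X by simp
  have "A * Y * A = A * (?Q + H) - (?Q + H) * A"
    using commutator_AXA[OF A X] by (simp add: Y quad)
  also have "\<dots> = (A * ?Q + A * H) - (?Q * A + H * A)"
    using mult_add_distrib_mat[OF A Q H] add_mult_distrib_mat[OF Q H A] by simp
  finally have AYA: "A * Y * A = (A * ?Q + A * H) - (?Q * A + H * A)" .
  have cancel: "P - R = (P + S) - (R + T) + T - S"
    if "P \<in> carrier_mat N N" "R \<in> carrier_mat N N" "S \<in> carrier_mat N N" "T \<in> carrier_mat N N"
    for P R S T :: "complex mat"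
    using that by (intro eq_matI) auto
  have "Y * A * X + X * A * Y = A * ?Q - ?Q * A"
    using commutator_XAX[OF A X] by (simp add: Y)
  also have "\<dots> = A * Y * A + H * A - A * H"
    unfolding AYA using A H Q by (intro cancel) auto
  finally show ?thesis
    using X unfolding solves_sylvester_def by simp
qed

lemma hat_Y2_carrier:
  assumes "A1 \<in> carrier_mat N1 N1" "A2 \<in> carrier_mat N2 N2" "invertible_mat A2"
    and "Y2 \<in> carrier_mat N1 N2"
  shows "hat_Y2 A1 A2 Y2 \<in> carrier_mat N1 N2"
  using assms mat_inv_invertible(1)[OF assms(2,3)] unfolding hat_Y2_def by auto

lemma hat_Y3_carrier:
  assumes "A1 \<in> carrier_mat N1 N1" "A2 \<in> carrier_mat N2 N2" "invertible_mat A2"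
    and "Y3 \<in> carrier_mat N2 N1"
  shows "hat_Y3 A1 A2 Y3 \<in> carrier_mat N2 N1"
  using assms mat_inv_invertible(1)[OF assms(2,3)] unfolding hat_Y3_def by auto

theorem theorem4p2:
  fixes N1 N2 n :: nat and t :: complex
    and A1 A2 Y2 Y3 Y4 H :: "complex mat"
  assumes A1: "A1 \<in> carrier_mat N1 N1" "A1 ^\<^sub>m 2 = 0\<^sub>m N1 N1"
    and A2: "A2 \<in> carrier_mat N2 N2" "invertible_mat A2"
    and nt: "n > 2" "t \<noteq> 0" "A2 ^\<^sub>m n = t \<cdot>\<^sub>m (A2 ^\<^sub>m 2)"
    and Y2: "Y2 \<in> carrier_mat N1 N2"
    and Y3: "Y3 \<in> carrier_mat N2 N1"
    and Y4: "Y4 \<in> carrier_mat N2 N2"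
    and H: "H = hat_Y3 A1 A2 Y3 * A1 * hat_Y2 A1 A2 Y2"
  shows "((\<exists>X4. solves_system N2 A2 H Y4 X4) \<longrightarrow>
            (\<forall>X4. solves_system N2 A2 H Y4 X4 \<longrightarrow> solves_sylvester N2 A2 H Y4 X4)) \<and>
         ((\<nexists>X4. solves_sylvester N2 A2 H Y4 X4) \<longrightarrow>
            (\<nexists>X4. solves_system N2 A2 H Y4 X4))"
proof -
  have "H \<in> carrier_mat N2 N2"
    unfolding H using hat_Y2_carrier[OF A1(1) A2 Y2] hat_Y3_carrier[OF A1(1) A2 Y3] A1(1) by auto
  with sylvester_if_system[OF A2(1)] show ?thesis by blast
qed

end
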